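(* For every square-free integer $d\geq 2$, $$ \frac{1}{2}\sqrt{D} < L(d) < \sqrt{D}. $$
   Context: For a polynomial $F(x)=a_n\prod_{i=1}^n(x-\alpha_i)\in\mathbb C[x]$ the Mahler measure is $M(F)=|a_n|\prod_{i=1}^n\max\{1,|\alpha_i|\}$. For an algebraic number $\alpha$, $M(\alpha)$ denotes the Mahler measure of a polynomial with root $\alpha$ that is irreducible in $\mathbb Z[x]$ (hence primitive). For square-free $d\ge 2$, $L(d):=\min\{M(\alpha) : \alpha\in\mathbb Q(\sqrt d)\setminus\mathbb Q\}$, and $D$ denotes the discriminant of $\mathbb Q(\sqrt d)$: $D=d$ if $d\equiv 1 \pmod 4$, and $D=4d$ if $d\equiv 2$ or $3\pmod 4$. *)

theory Defs
  imports
    "HOL-Computational_Algebra.Computational_Algebra"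
    "Berlekamp_Zassenhaus.Mahler_Measure"
begin

(* An irreducible integer polynomial with root x is unique up to sign, so the value does not
   depend on the choice.  Irreducibility is taken in the ring of integer polynomials, so the
   polynomial is primitive.  Meaningful only for algebraic x. *)
definition alg_mahler_measure :: "complex \<Rightarrow> real" where
  "alg_mahler_measure x =
     mahler_measure (SOME f :: int poly. irreducible f \<and> poly (map_poly of_int f) x = 0)"

(* Q(sqrt d) as a subfield of the complex numbers, for d \<ge> 0 *)
definition quadratic_field :: "int \<Rightarrow> complex set" where
  "quadratic_field d =
     {of_rat a + of_rat b * complex_of_real (sqrt (real_of_int d)) | a b. True}"

(* LEAST on the reals denotes an attained minimum: it is unspecified if there is none,
   unlike an infimum. *)
definition min_mahler_measure :: "int \<Rightarrow> real" where
  "min_mahler_measure d =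
     (LEAST m. \<exists>x \<in> quadratic_field d - \<rat>. m = alg_mahler_measure x)"

(* for square-free d *)
definition quadratic_discriminant :: "int \<Rightarrow> int" where
  "quadratic_discriminant d = (if [d = 1] (mod 4) then d else 4 * d)"

end

theory Submission
  imports Defs "Berlekamp_Zassenhaus.Factor_Bound"
begin

text \<open>Let $x$ generate $K = \mathbb{Q}(\sqrt d)$ and let $f = aX^2 + bX + c$ be its irreducible integer
  polynomial, with roots $x$ and its conjugate $x'$. Both bounds compare $M(x)$ with
  $|a|\,|x - x'| = \sqrt{b^2 - 4ac}$.

  Lower bound. The discriminant of $f$ is a nonzero rational square times $d$; as $d$ is squarefree,
  the square is that of an integer, and reduction modulo 4 yields $b^2 - 4ac \ge D$
  (\<open>quadratic_discriminant_le\<close>). On the other hand $|x - x'| < 2 \max\{1,|x|\}\max\{1,|x'|\}$ as soon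
  as neither $x$ nor $x'$ is $\pm 1$ (\<open>abs_diff_less_Mahler_factor\<close>). Together these give
  $\sqrt D < 2 M(x)$ for every $x \in K \setminus \mathbb{Q}$.

  Upper bound. Among the integers congruent to $D$ modulo 2 let $b$ be the largest one below $\sqrt D$,
  and put $x = (b + \sqrt D)/2$. It is a root of the monic polynomial $X^2 - bX + (b^2 - D)/4$, whose
  other root lies in $[-1, 0)$ because $b \ge \sqrt D - 2$. Hence
  $M(x) \le \max\{1, x\} < \sqrt D$ (\<open>exists_small_mahler_measure\<close>).

  The minimum. The coefficients of an integer polynomial of degree 2 are at most twice its Mahler
  measure, so only finitely many such polynomials have Mahler measure below a given bound. The minimum
  defining $L(d)$ is therefore attained (\<open>min_mahler_measure_attained\<close>), and the two bounds apply to it.\<close>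

section \<open>Irreducible integer polynomials with a given root\<close>

text \<open>A nonzero polynomial $m$ of least degree with root $x$ divides every other such polynomial up to
  a constant factor, by pseudo-division. Since $f$ is prime in $\mathbb{Z}[X]$ and divides no nonzero
  constant, it divides $m$, and then also $g$. In particular, $f$ is determined by $x$ up to sign.\<close>

lemma irreducible_dvd_of_common_root:
  fixes f g :: "int poly" and x :: complex
  assumes "irreducible f" "g \<noteq> 0"
    and fx: "poly (of_int_poly f) x = 0" and gx: "poly (of_int_poly g) x = 0"
  shows "f dvd g"
proof -
  define P where "P h \<longleftrightarrow> h \<noteq> 0 \<and> poly (of_int_poly h) x = 0" for h :: "int poly"
  have "P g" using assms by (simp add: P_def)
  then obtain m where m: "P m" and least: "\<And>h. P h \<Longrightarrow> degree m \<le> degree h"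
    using ex_has_least_nat[of P g degree] by blast
  have m0: "m \<noteq> 0" and mx: "poly (of_int_poly m) x = 0" using m by (auto simp: P_def)
  have multiple: "\<exists>c q. c \<noteq> 0 \<and> Polynomial.smult c h = m * q"
    if hx: "poly (of_int_poly h) x = 0" for h :: "int poly"
  proof -
    obtain c q where c: "c \<noteq> 0" and q: "Polynomial.smult c h = m * q + pseudo_mod h m"
      using pseudo_mod(1)[OF m0, of h] by blast
    have "poly (of_int_poly (Polynomial.smult c h)) x = poly (of_int_poly (m * q + pseudo_mod h m)) x"
      by (simp only: q)
    hence "poly (of_int_poly (pseudo_mod h m)) x = 0"
      using hx mx by (simp add: hom_distribs)
    hence "pseudo_mod h m = 0"
      using pseudo_mod(2)[OF m0, of h] least[of "pseudo_mod h m"]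
      unfolding P_def by linarith
    thus ?thesis using c q by auto
  qed
  have f0: "f \<noteq> 0" using assms(1) by auto
  have prime: "prime_elem f" using assms(1) by (simp add: prime_elem_iff_irreducible)
  have not_const: "\<not> f dvd [:c:]" if "c \<noteq> 0" for c
  proof
    assume "f dvd [:c:]"
    then obtain h where h: "[:c:] = f * h" by (elim dvdE)
    have "poly (of_int_poly [:c:]) x = poly (of_int_poly f) x * poly (of_int_poly h) x"
      unfolding h by (simp add: hom_distribs)
    thus False using fx that by simp
  qed
  obtain c q where c: "c \<noteq> 0" and q: "Polynomial.smult c f = m * q" using multiple[OF fx] by blast
  have "f dvd m * q" unfolding q[symmetric] by (simp add: dvd_smult)
  \<comment> \<open>Otherwise \<open>m\<close> would divide the nonzero constant \<open>c\<close>, although \<open>m\<close> has a root.\<close>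
  moreover have "\<not> f dvd q"
  proof
    assume "f dvd q"
    then obtain s where "q = f * s" by (elim dvdE)
    hence "f * [:c:] = f * (m * s)" using q by (simp add: ac_simps)
    hence cm: "[:c:] = m * s" using f0 by (simp only: mult_cancel_left) simp
    have "poly (of_int_poly [:c:]) x = poly (of_int_poly m) x * poly (of_int_poly s) x"
      unfolding cm by (simp add: hom_distribs)
    thus False using mx c by simp
  qed
  ultimately have "f dvd m" using prime_elem_dvd_multD[OF prime, of m q] by simp
  moreover obtain e r where e: "e \<noteq> 0" and r: "Polynomial.smult e g = m * r" using multiple[OF gx] by blast
  ultimately have "f dvd [:e:] * g" by simp
  thus ?thesis using not_const[OF e] prime_elem_dvd_multD[OF prime, of "[:e:]" g] by simp
qed

lemma irreducible_factor_with_root: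
  fixes g :: "int poly" and x :: complex
  assumes "g \<noteq> 0" and "poly (of_int_poly g) x = 0"
  shows "\<exists>f :: int poly. irreducible f \<and> poly (of_int_poly f) x = 0"
  using assms
proof (induction g rule: prime_divisors_induct)
  case (unit u)
  then obtain v where v: "1 = u * v" by (elim dvdE)
  have "poly (of_int_poly (1 :: int poly)) x = poly (of_int_poly u) x * poly (of_int_poly v) x"
    unfolding v by (simp add: hom_distribs)
  thus ?case using unit by simp
next
  case (factor p g)
  thus ?case
    by (cases "poly (of_int_poly p) x = 0")
       (auto simp: hom_distribs intro: prime_elem_imp_irreducible)
qed simp

section \<open>Squarefree integers and quadratic discriminants\<close>

text \<open>If $r = u/v$ in lowest terms, then $u^2 d = n v^2$ forces $v^2 \mid d$, so $v$ is a unit.\<close>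

lemma rational_square_root_integral:
  fixes d n :: int and r :: rat
  assumes "squarefree d" and eq: "r\<^sup>2 * of_int d = of_int n"
  shows "\<exists>k. r = of_int k"
proof -
  obtain u v where uv: "quotient_of r = (u, v)" by (cases "quotient_of r")
  have v: "v > 0" using quotient_of_denom_pos[OF uv] .
  have r: "r = of_int u / of_int v" using quotient_of_div[OF uv] .
  have cop: "algebraic_semidom_class.coprime u v" using quotient_of_coprime[OF uv] .
  have "of_int u ^ 2 * of_int d / of_int v ^ 2 = (of_int n :: rat)"
    using eq by (simp add: r power_divide)
  moreover have "(of_int v :: rat) ^ 2 \<noteq> 0" using v by simp
  ultimately have "of_int u ^ 2 * of_int d = (of_int n * of_int v ^ 2 :: rat)"
    by (rule iffD1[OF nonzero_divide_eq_eq, rotated])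
  hence "of_int (u\<^sup>2 * d) = (of_int (n * v\<^sup>2) :: rat)" by simp
  hence "u\<^sup>2 * d = n * v\<^sup>2" by (simp only: of_int_eq_iff)
  hence "v\<^sup>2 dvd u\<^sup>2 * d" by simp
  moreover have "algebraic_semidom_class.coprime (v\<^sup>2) (u\<^sup>2)" using cop by (simp add: ac_simps)
  ultimately have "v\<^sup>2 dvd d" by (simp add: semiring_gcd_class.coprime_dvd_mult_right_iff)
  hence "is_unit v" using assms(1) by (simp add: squarefree_def)
  hence "v = 1" using v by simp
  thus ?thesis using r by auto
qed

text \<open>If $\sqrt d = r$ were rational, then $(1/r)^2 d = 1$, so $1/r$ would be an integer $k$ with
  $k^2 d = 1$.\<close>

lemma sqrt_squarefree_irrational:
  fixes d :: int
  assumes "squarefree d" and "d \<ge> 2"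
  shows "sqrt (of_int d) \<noteq> of_rat r"
proof
  assume eq: "sqrt (of_int d) = of_rat r"
  have "(sqrt (of_int d))\<^sup>2 = of_int d" using assms(2) by simp
  hence "(of_rat (of_int d) :: real) = of_rat (r\<^sup>2)" by (simp add: of_rat_power eq)
  hence d: "of_int d = r\<^sup>2" by (simp only: of_rat_eq_iff)
  have "(of_int d :: rat) \<noteq> 0" using assms(2) by simp
  hence "r\<^sup>2 \<noteq> 0" unfolding d .
  hence unit: "(1 / r)\<^sup>2 * of_int d = of_int 1" unfolding d by (simp add: power_divide)
  then obtain k where "1 / r = of_int k"
    using rational_square_root_integral[OF assms(1)] by blast
  with unit have "(of_int (k\<^sup>2 * d) :: rat) = of_int 1" by simp
  hence "k\<^sup>2 * d = 1" by (simp only: of_int_eq_iff)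
  hence "d dvd 1" by (metis dvd_triv_right)
  thus False using assms(2) by simp
qed

lemma rational_combination_eqD:
  fixes d :: int
  assumes "squarefree d" "d \<ge> 2"
    and eq: "of_rat u + of_rat v * sqrt (of_int d) = of_rat w"
  shows "v = 0 \<and> u = w"
proof -
  have v: "v = 0"
  proof (rule ccontr)
    assume "v \<noteq> 0"
    hence "sqrt (of_int d) = of_rat ((w - u) / v)"
      using eq by (simp add: of_rat_diff of_rat_divide field_simps)
    thus False using sqrt_squarefree_irrational[OF assms(1,2)] by blast
  qed
  thus ?thesis using eq by simp
qed

text \<open>The hypothesis makes $r$ a nonzero integer, so $r^2 d \ge d$, which suffices if
  $d \equiv 1 \pmod 4$. Otherwise $r$ must be even, whence $r^2 d \ge 4d$: an odd $r$ would give
  $b^2 \equiv d \pmod 4$, and then $d$ would be congruent to 0 or 1 modulo 4, while a squarefree $d$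
  is not divisible by 4.\<close>

lemma quadratic_discriminant_le:
  fixes a b c d :: int
  assumes "squarefree d" "d \<ge> 2" and r0: "r \<noteq> 0"
    and eq: "r\<^sup>2 * of_int d = (of_int (b\<^sup>2 - 4 * a * c) :: rat)"
  shows "quadratic_discriminant d \<le> b\<^sup>2 - 4 * a * c"
proof -
  obtain k where k: "r = of_int k" using rational_square_root_integral[OF assms(1) eq] by blast
  have "(of_int (k\<^sup>2 * d) :: rat) = of_int (b\<^sup>2 - 4 * a * c)" using eq by (simp add: k)
  hence kd: "k\<^sup>2 * d = b\<^sup>2 - 4 * a * c" by (simp only: of_int_eq_iff)
  have k0: "k \<noteq> 0" using r0 k by auto
  show ?thesis
  proof (cases "[d = 1] (mod 4) \<or> even k")
    case True
    have "s * d \<le> k\<^sup>2 * d" if "s \<le> k\<^sup>2" for s using that assms(2) by (intro mult_right_mono) auto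
    moreover have "1 \<le> k\<^sup>2" using k0 by (simp add: int_one_le_iff_zero_less)
    moreover have "4 \<le> k\<^sup>2" if "even k"
    proof -
      obtain j where "k = 2 * j" using \<open>even k\<close> by blast
      moreover from this have "1 \<le> j\<^sup>2" using k0 by (simp add: int_one_le_iff_zero_less)
      ultimately show ?thesis by (simp add: power_mult_distrib)
    qed
    ultimately have "(if [d = 1] (mod 4) then 1 else 4) * d \<le> k\<^sup>2 * d"
      using True by (metis (full_types))
    thus ?thesis unfolding kd quadratic_discriminant_def by (simp split: if_splits)
  next
    case False
    then obtain j where j: "k = 2 * j + 1" by (auto elim: oddE)
    have d4: "d mod 4 \<noteq> 1" "d mod 4 \<noteq> 0"
    proof -
      show "d mod 4 \<noteq> 1" using False by (simp add: cong_def)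
      show "d mod 4 \<noteq> 0"
      proof
        assume "d mod 4 = 0"
        hence "2\<^sup>2 dvd d" by auto
        hence "is_unit (2 :: int)" using assms(1) unfolding squarefree_def by blast
        thus False by simp
      qed
    qed
    have "(b\<^sup>2) mod 4 = (d + 4 * ((j * j + j) * d + a * c)) mod 4"
      using kd by (intro arg_cong[where f = "\<lambda>z. z mod 4"]) (simp add: j power2_eq_square algebra_simps)
    hence "b\<^sup>2 mod 4 = d mod 4" by (simp only: mod_mult_self2)
    moreover have "b\<^sup>2 mod 4 = 0 \<or> b\<^sup>2 mod 4 = 1"
    proof (cases "even b")
      case True
      then obtain i where "b = 2 * i" by blast
      thus ?thesis by (simp add: power2_eq_square)
    next
      case False
      then obtain i where "b = 2 * i + 1" by (elim oddE)
      hence "b\<^sup>2 = 1 + 4 * (i * i + i)" by (simp add: power2_eq_square algebra_simps)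
      hence "b\<^sup>2 mod 4 = 1 mod 4" by (simp only: mod_mult_self2)
      thus ?thesis by simp
    qed
    ultimately show ?thesis using d4 by simp
  qed
qed

section \<open>Mahler measures of quadratic polynomials\<close>

text \<open>Bounding $|x - y|$ by $|x| + |y|$ gives the non-strict inequality at once. It is strict because
  equality would require $|x| = |y| = 1$.\<close>

lemma abs_diff_less_Mahler_factor:
  fixes x y :: real
  assumes "\<bar>x\<bar> \<noteq> 1" "\<bar>y\<bar> \<noteq> 1"
  shows "\<bar>x - y\<bar> < 2 * (max 1 \<bar>x\<bar> * max 1 \<bar>y\<bar>)"
proof -
  have *: "s + t < 2 * (max 1 s * max 1 t)" if "s \<noteq> 1" "t \<noteq> 1" "t \<le> s" for s t :: real
  proof (cases "1 < t")
    case True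
    have "s + t \<le> 2 * s" using that by simp
    also have "\<dots> < 2 * (s * t)" using True that by simp
    finally show ?thesis using True that by simp
  next
    case False
    thus ?thesis using that by (simp add: max_def)
  qed
  have "\<bar>x\<bar> + \<bar>y\<bar> < 2 * (max 1 \<bar>x\<bar> * max 1 \<bar>y\<bar>)"
    using *[of "\<bar>x\<bar>" "\<bar>y\<bar>"] *[of "\<bar>y\<bar>" "\<bar>x\<bar>"] assms by (cases "\<bar>y\<bar> \<le> \<bar>x\<bar>") (auto simp: ac_simps)
  thus ?thesis by linarith
qed

lemma poly_degree_le_2_eq:
  assumes "degree f \<le> 2"
  shows "f = [:poly.coeff f 0, poly.coeff f 1, poly.coeff f 2:]"
proof (rule poly_eqI)
  fix i :: nat
  consider "i = 0" | "i = 1" | "i = 2" | "i > 2" by linarith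
  thus "poly.coeff f i = poly.coeff [:poly.coeff f 0, poly.coeff f 1, poly.coeff f 2:] i"
  proof cases
    case 4
    thus ?thesis using assms by (simp add: coeff_eq_0 coeff_pCons split: nat.split)
  qed (simp_all add: numeral_2_eq_2)
qed

lemma of_int_poly_quadratic:
  "of_int_poly [:c, b, a:] = [:of_int c, of_int b, of_int a :: 'a :: ring_1:]"
  by (rule poly_eqI) (simp add: coeff_map_poly coeff_pCons split: nat.split)

lemma mahler_measure_quadratic:
  fixes a b c :: int and x y :: real
  assumes "of_int b = - of_int a * (x + y)" "of_int c = of_int a * (x * y)"
  shows "mahler_measure [:c, b, a:] = \<bar>of_int a\<bar> * (max 1 \<bar>x\<bar> * max 1 \<bar>y\<bar>)"
proof -
  have bc: "complex_of_int b = complex_of_real (- of_int a * (x + y))"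
    "complex_of_int c = complex_of_real (of_int a * (x * y))"
    by (simp_all only: assms(1)[symmetric] assms(2)[symmetric] of_real_of_int_eq)
  have "of_int_poly [:c, b, a:] = [:complex_of_int c, complex_of_int b, complex_of_int a:]"
    by (rule of_int_poly_quadratic)
  also have "\<dots> =
      Polynomial.smult (complex_of_int a) (\<Prod>z\<leftarrow>[complex_of_real x, complex_of_real y]. [:- z, 1:])"
    unfolding bc by (simp add: algebra_simps)
  finally show ?thesis
    unfolding mahler_measure_def by (simp only: mahler_measure_poly_explicit) simp
qed

text \<open>Mignotte's bound confines all coefficients to $[-2B, 2B]$, as the binomial coefficients
  ${2 \choose i}$ are at most 2.\<close>

lemma finite_bounded_mahler_measure:
  "finite {f :: int poly. degree f = 2 \<and> mahler_measure f \<le> B}"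
proof (rule finite_subset)
  define N where "N = \<lceil>2 * B\<rceil>"
  have "f \<in> (\<lambda>(c, b, a). [:c, b, a:]) ` ({- N..N} \<times> {- N..N} \<times> {- N..N})"
    if deg: "degree f = 2" and M: "mahler_measure f \<le> B" for f :: "int poly"
  proof -
    have coeff: "poly.coeff f i \<in> {- N..N}" if "i \<le> 2" for i
    proof -
      have "real (2 choose i) \<le> 2"
      proof -
        consider "i = 0" | "i = 1" | "i = 2" using \<open>i \<le> 2\<close> by linarith
        thus ?thesis by cases auto
      qed
      hence "real (2 choose i) * mahler_measure f \<le> 2 * B"
        using M by (intro mult_mono) (auto simp: mahler_measure_ge_0)
      hence "real_of_int \<bar>poly.coeff f i\<bar> \<le> 2 * B" using Mignotte_bound[of f i] by (simp add: deg)
      hence "\<bar>poly.coeff f i\<bar> \<le> N" unfolding N_def by linarith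
      thus ?thesis by auto
    qed
    have "f = [:poly.coeff f 0, poly.coeff f 1, poly.coeff f 2:]"
      using deg by (intro poly_degree_le_2_eq) simp
    moreover have "(poly.coeff f 0, poly.coeff f 1, poly.coeff f 2) \<in> {- N..N} \<times> {- N..N} \<times> {- N..N}"
      using coeff by auto
    ultimately show ?thesis
      by (intro image_eqI[where x = "(poly.coeff f 0, poly.coeff f 1, poly.coeff f 2)"]) simp_all
  qed
  thus "{f :: int poly. degree f = 2 \<and> mahler_measure f \<le> B}
      \<subseteq> (\<lambda>(c, b, a). [:c, b, a:]) ` ({- N..N} \<times> {- N..N} \<times> {- N..N})" by blast
qed auto

section \<open>Elements of a real quadratic field\<close>

lemma complex_of_real_of_rat: "complex_of_real (of_rat r) = of_rat r"
  by (cases r) (simp add: of_rat_rat)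

text \<open>Clearing denominators in $(x - p)^2 = q^2 d$, where $x = p + q \sqrt d$.\<close>

lemma quadratic_field_root:
  assumes "d \<ge> 0" "x \<in> quadratic_field d"
  obtains n b c :: int where "n \<noteq> 0" "poly (of_int_poly [:c, b, n:]) x = 0"
proof -
  obtain p q where x: "x = of_rat p + of_rat q * complex_of_real (sqrt (of_int d))"
    using assms(2) unfolding quadratic_field_def by blast
  obtain P m where Pm: "quotient_of p = (P, m)" by (cases "quotient_of p")
  have p: "p = of_int P / of_int m" and m: "m > 0"
    using quotient_of_div[OF Pm] quotient_of_denom_pos[OF Pm] .
  obtain Q n where Qn: "quotient_of q = (Q, n)" by (cases "quotient_of q")
  have q: "q = of_int Q / of_int n" and n: "n > 0"
    using quotient_of_div[OF Qn] quotient_of_denom_pos[OF Qn] .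
  have s: "(complex_of_real (sqrt (of_int d)))\<^sup>2 = of_int d"
    using assms(1) by (simp flip: of_real_power)
  let ?f = "[:P\<^sup>2 * n\<^sup>2 - d * Q\<^sup>2 * m\<^sup>2, - 2 * (m * n) * (P * n), (m * n)\<^sup>2:]"
  have "complex_of_int m * of_int n * x = of_int P * of_int n + of_int Q * of_int m * complex_of_real (sqrt (of_int d))"
    using m n unfolding x p q by (simp add: of_rat_divide field_simps)
  hence "(of_int m * of_int n * x - of_int P * of_int n)\<^sup>2 = (of_int Q * of_int m)\<^sup>2 * of_int d"
    by (simp add: power_mult_distrib s)
  hence "poly (of_int_poly ?f) x = 0"
    unfolding of_int_poly_quadratic by (simp add: power2_eq_square algebra_simps)
  moreover have "(m * n)\<^sup>2 \<noteq> 0" using m n by simp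
  ultimately show thesis by (intro that)
qed

text \<open>The degree is at most 2 because $f$ divides a quadratic polynomial, and at least 2 because $x$ is
  irrational. With $x = p + q\sqrt d$, comparing the coefficients of $1$ and $\sqrt d$ in $f(x) = 0$ shows that the
  conjugate $p - q\sqrt d$ is the other root and that the discriminant of $f$ is $(2aq)^2 d$. The lower
  bound then results from $\sqrt D \le |a|\,|2q\sqrt d| = |a|\,|y - z|$, where $y$ and $z$ are the two
  roots as real numbers.\<close>

lemma minimal_polynomial_quadratic:
  fixes d :: int
  assumes d: "squarefree d" "d \<ge> 2" and x: "x \<in> quadratic_field d - \<rat>"
    and irr: "irreducible f" and root: "poly (of_int_poly f) x = 0"
  shows "degree f = 2"
    and "sqrt (of_int (quadratic_discriminant d)) < 2 * mahler_measure f"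
proof -
  define s where "s = sqrt (of_int d)"
  have s2: "s\<^sup>2 = of_int d" using d(2) by (simp add: s_def)
  obtain n b' c' :: int where n: "n \<noteq> 0" and g: "poly (of_int_poly [:c', b', n:]) x = 0"
    by (rule quadratic_field_root[of d x]) (use d x in auto)
  hence "f dvd [:c', b', n:]" by (intro irreducible_dvd_of_common_root[OF irr _ root]) auto
  hence "degree f \<le> degree [:c', b', n:]" using n by (intro dvd_imp_degree_le) auto
  hence deg_le: "degree f \<le> 2" using n by simp
  define a b c where "a = poly.coeff f 2" and "b = poly.coeff f 1" and "c = poly.coeff f 0"
  have f: "f = [:c, b, a:]"
    unfolding a_def b_def c_def using deg_le by (rule poly_degree_le_2_eq)
  have f0: "f \<noteq> 0" using irr by auto
  have a0: "a \<noteq> 0"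
  proof
    assume a: "a = 0"
    have eq: "of_int c + of_int b * x = 0" using root of_int_poly_quadratic[of c b a, where ?'a = complex]
    by (simp add: f a mult.commute)
    have "b \<noteq> 0" using eq f0 by (auto simp: f a)
    hence "x = - of_int c / of_int b" using eq by (simp add: field_simps eq_neg_iff_add_eq_0)
    hence "x \<in> \<rat>" by simp
    thus False using x by simp
  qed
  thus "degree f = 2" by (simp add: f)
  obtain p q where xpq: "x = of_rat p + of_rat q * complex_of_real s"
    using x unfolding quadratic_field_def s_def by blast
  define y z where "y = of_rat p + of_rat q * s" and "z = of_rat p - of_rat q * s"
  have xy: "x = complex_of_real y" by (simp add: xpq y_def complex_of_real_of_rat)
  have q0: "q \<noteq> 0" using x by (auto simp: xpq)
  have "complex_of_real (of_int a * y\<^sup>2 + of_int b * y + of_int c) = 0"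
    using root by (simp add: f xy of_int_poly_quadratic power2_eq_square algebra_simps)
  hence "of_int a * y\<^sup>2 + of_int b * y + of_int c = 0" by (simp only: of_real_eq_0_iff)
  moreover have "y\<^sup>2 = of_rat p ^ 2 + of_rat q ^ 2 * of_int d + 2 * of_rat p * of_rat q * s"
    unfolding y_def s2[symmetric] by (simp add: power2_eq_square algebra_simps)
  ultimately have "of_rat (of_int a * (p\<^sup>2 + q\<^sup>2 * of_int d) + of_int b * p + of_int c)
      + of_rat (q * (2 * of_int a * p + of_int b)) * s = of_rat 0"
    by (simp add: y_def of_rat_add of_rat_mult of_rat_power algebra_simps)
  from rational_combination_eqD[OF d this[unfolded s_def]] q0
  have b: "of_int b = - 2 * of_int a * p"
    and c: "of_int a * (p\<^sup>2 + q\<^sup>2 * of_int d) + of_int b * p + of_int c = 0"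
    by (auto simp: eq_neg_iff_add_eq_0 add.commute)
  have c: "of_int c = of_int a * (p\<^sup>2 - q\<^sup>2 * of_int d)"
    using c unfolding b by (simp add: power2_eq_square algebra_simps)
  have "(2 * of_int a * q)\<^sup>2 * of_int d = (of_int (b\<^sup>2 - 4 * a * c) :: rat)"
    by (simp add: b c power2_eq_square algebra_simps)
  hence D: "quadratic_discriminant d \<le> b\<^sup>2 - 4 * a * c"
    by (rule quadratic_discriminant_le[OF d, rotated]) (use a0 q0 in auto)
  have "(of_rat (of_int b) :: real) = of_rat (- 2 * of_int a * p)"
    "(of_rat (of_int c) :: real) = of_rat (of_int a * (p\<^sup>2 - q\<^sup>2 * of_int d))"
    by (simp_all only: b c)
  hence vieta: "real_of_int b = - of_int a * (y + z)" "real_of_int c = of_int a * (y * z)"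
    by (simp_all add: y_def z_def of_rat_mult of_rat_diff of_rat_power of_rat_minus s2[symmetric]
        power2_eq_square algebra_simps)
  \<comment> \<open>Strictness of the final estimate rests on the irrationality of both roots.\<close>
  have irrational: "\<bar>y\<bar> \<noteq> 1" "\<bar>z\<bar> \<noteq> 1"
  proof -
    have "y \<noteq> of_rat w" for w
      using rational_combination_eqD[OF d, of p q w] q0 by (auto simp: y_def s_def)
    from this[of 1] this[of "- 1"] show "\<bar>y\<bar> \<noteq> 1" by (auto simp: abs_if split: if_splits)
    have "z \<noteq> of_rat w" for w
      using rational_combination_eqD[OF d, of p "- q" w] q0 by (auto simp: z_def s_def of_rat_minus)
    from this[of 1] this[of "- 1"] show "\<bar>z\<bar> \<noteq> 1" by (auto simp: abs_if split: if_splits)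
  qed
  have "sqrt (of_int (quadratic_discriminant d)) \<le> sqrt (real_of_int (b\<^sup>2 - 4 * a * c))"
    using D by (simp only: real_sqrt_le_iff of_int_le_iff)
  also have "real_of_int (b\<^sup>2 - 4 * a * c) = (of_int a * (y - z))\<^sup>2"
    by (simp add: vieta power2_eq_square algebra_simps)
  also have "sqrt \<dots> = \<bar>of_int a\<bar> * \<bar>y - z\<bar>" by (simp add: abs_mult)
  also have "\<dots> < \<bar>of_int a\<bar> * (2 * (max 1 \<bar>y\<bar> * max 1 \<bar>z\<bar>))"
    using a0 by (intro mult_strict_left_mono abs_diff_less_Mahler_factor irrational) auto
  also have "\<dots> = 2 * mahler_measure f"
    unfolding f mahler_measure_quadratic[OF vieta] by simp
  finally show "sqrt (of_int (quadratic_discriminant d)) < 2 * mahler_measure f" .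
qed

text \<open>Replaces the choice in the definition of \<open>alg_mahler_measure\<close> by a polynomial known to have the
  chosen properties.\<close>

lemma alg_mahler_measure_irreducible:
  assumes "d \<ge> 0" "x \<in> quadratic_field d"
  obtains f :: "int poly" where "irreducible f" "poly (of_int_poly f) x = 0"
    "alg_mahler_measure x = mahler_measure f"
proof -
  obtain n b c :: int where "n \<noteq> 0" "poly (of_int_poly [:c, b, n:]) x = 0"
    using quadratic_field_root[OF assms] .
  hence "\<exists>f :: int poly. irreducible f \<and> poly (of_int_poly f) x = 0"
    by (intro irreducible_factor_with_root[of "[:c, b, n:]"]) auto
  from someI_ex[OF this] show thesis
    by (intro that) (auto simp: alg_mahler_measure_def)
qed

section \<open>The minimum and its upper bound\<close>

text \<open>Only values up to that of $x$ compete for the minimum, and they form a finite nonempty set.\<close>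

lemma min_mahler_measure_attained:
  fixes d :: int
  assumes d: "squarefree d" "d \<ge> 2" and x: "x \<in> quadratic_field d - \<rat>"
  shows "\<exists>y \<in> quadratic_field d - \<rat>. min_mahler_measure d = alg_mahler_measure y"
    and "min_mahler_measure d \<le> alg_mahler_measure x"
proof -
  let ?K = "quadratic_field d - \<rat>"
  define S where "S = {m \<in> alg_mahler_measure ` ?K. m \<le> alg_mahler_measure x}"
  have "S \<subseteq> mahler_measure ` {f. degree f = 2 \<and> mahler_measure f \<le> alg_mahler_measure x}"
  proof
    fix m assume "m \<in> S"
    then obtain y where y: "y \<in> ?K" and m: "m = alg_mahler_measure y" "m \<le> alg_mahler_measure x"
      by (auto simp: S_def)
    obtain f :: "int poly" where f: "irreducible f" "poly (of_int_poly f) y = 0"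
      "alg_mahler_measure y = mahler_measure f"
      using alg_mahler_measure_irreducible[of d y] d y by auto
    moreover have "degree f = 2" using minimal_polynomial_quadratic(1)[OF d y f(1,2)] .
    ultimately show "m \<in> mahler_measure ` {f. degree f = 2 \<and> mahler_measure f \<le> alg_mahler_measure x}"
      using m by auto
  qed
  hence fin: "finite S" by (rule finite_subset) (intro finite_imageI finite_bounded_mahler_measure)
  have xS: "alg_mahler_measure x \<in> S" using x by (auto simp: S_def)
  hence "Min S \<in> S" using fin by (intro Min_in) auto
  then obtain y where y: "y \<in> ?K" "Min S = alg_mahler_measure y" by (auto simp: S_def)
  have min: "min_mahler_measure d = Min S"
    unfolding min_mahler_measure_def
  proof (rule Least_equality)
    show "\<exists>x\<in>?K. Min S = alg_mahler_measure x" using y by blast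
    fix m assume "\<exists>z\<in>?K. m = alg_mahler_measure z"
    hence "m \<in> S \<or> alg_mahler_measure x < m" by (auto simp: S_def)
    thus "Min S \<le> m" using Min_le[OF fin, of m] Min_le[OF fin xS] by linarith
  qed
  show "\<exists>y\<in>?K. min_mahler_measure d = alg_mahler_measure y" using min y by auto
  show "min_mahler_measure d \<le> alg_mahler_measure x" using min Min_le[OF fin xS] by simp
qed

lemma sqrt_window_parity:
  fixes D :: int
  assumes "D \<ge> 0"
  obtains b :: int where "even (b - D)" "sqrt (of_int D) - 2 \<le> b" "b < sqrt (of_int D)"
proof -
  \<comment> \<open>Rounding up and subtracting 1, instead of rounding down, keeps \<open>n\<close> strictly below \<open>sqrt D\<close>
    when \<open>D\<close> is a perfect square.\<close>
  define n where "n = \<lceil>sqrt (of_int D)\<rceil> - 1"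
  have n: "sqrt (of_int D) - 1 \<le> n" "n < sqrt (of_int D)" unfolding n_def by linarith+
  show thesis
  proof (cases "even (n - D)")
    case True
    thus thesis using n by (intro that[of n]) auto
  next
    case False
    thus thesis using n by (intro that[of "n - 1"]) auto
  qed
qed

text \<open>The witness is $x = (b + \sqrt D)/2$, with $b \equiv D \pmod 2$ and $\sqrt D - 2 \le b < \sqrt D$. The
  congruence makes $(b^2 - D)/4$ an integer, and the two inequalities place the conjugate of $x$ in
  $[-1, 0)$, so that the Mahler measure sees only $x$.\<close>

lemma exists_small_mahler_measure:
  fixes d :: int
  assumes d: "squarefree d" "d \<ge> 2"
  shows "\<exists>x \<in> quadratic_field d - \<rat>. alg_mahler_measure x < sqrt (of_int (quadratic_discriminant d))"
proof -
  define D where "D = quadratic_discriminant d"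
  \<comment> \<open>The integer \<open>t\<close> satisfies $\sqrt D = t \sqrt d$, which shows that \<open>x\<close> lies in the field.\<close>
  define t :: int where "t = (if [d = 1] (mod 4) then 1 else 2)"
  have t: "t > 0" and Dt: "D = t\<^sup>2 * d" by (auto simp: D_def t_def quadratic_discriminant_def)
  have D1: "D > 1" using d(2) by (auto simp: D_def quadratic_discriminant_def)
  have sqrtD: "sqrt (of_int D) = of_int t * sqrt (of_int d)"
    using t by (simp add: Dt real_sqrt_mult)
  obtain b :: int where par: "even (b - D)" and b: "sqrt (of_int D) - 2 \<le> b" "b < sqrt (of_int D)"
    using sqrt_window_parity[of D] D1 by auto
  have "4 dvd b\<^sup>2 - D"
  proof (cases "[d = 1] (mod 4)")
    case True
    hence D: "D mod 4 = 1" by (simp add: D_def quadratic_discriminant_def cong_def)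
    hence "odd b" using par by presburger
    then obtain i where "b = 2 * i + 1" by (elim oddE)
    hence "b\<^sup>2 - D = 4 * (i * i + i) - (D - 1)" by (simp add: power2_eq_square algebra_simps)
    moreover have "4 dvd D - 1" using D by presburger
    ultimately show ?thesis by (simp only: dvd_diff dvd_triv_left)
  next
    case False
    hence D: "D = 4 * d" by (simp add: D_def quadratic_discriminant_def)
    hence "even b" using par by simp
    then obtain i where "b = 2 * i" by blast
    thus ?thesis by (simp add: D power_mult_distrib)
  qed
  then obtain c where c: "b\<^sup>2 - D = 4 * c" by blast
  define y z where "y = (b + sqrt (of_int D)) / 2" and "z = (b - sqrt (of_int D)) / 2"
  have "sqrt (of_int D) ^ 2 = of_int D" using D1 by simp
  hence "4 * (y * z) = of_int (b\<^sup>2 - D)"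
    by (simp add: y_def z_def power2_eq_square field_simps)
  hence vieta: "of_int (- b) = - of_int 1 * (y + z)" "of_int c = of_int 1 * (y * z)"
    by (simp_all add: c) (simp add: y_def z_def field_simps)
  let ?x = "complex_of_real y"
  have y: "y = of_rat (of_int b / 2) + of_rat (of_int t / 2) * sqrt (of_int d)"
    by (simp add: y_def sqrtD of_rat_divide add_divide_distrib)
  hence "?x = of_rat (of_int b / 2) + of_rat (of_int t / 2) * complex_of_real (sqrt (of_int d))"
    by (simp only: of_real_add of_real_mult complex_of_real_of_rat)
  hence inK: "?x \<in> quadratic_field d" unfolding quadratic_field_def by blast
  have "?x \<notin> \<rat>"
  proof
    assume "?x \<in> \<rat>"
    then obtain w where "?x = of_rat w" by (elim Rats_cases)
    hence "complex_of_real y = complex_of_real (of_rat w)" by (simp only: complex_of_real_of_rat)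
    hence "y = of_rat w" by (simp only: of_real_eq_iff)
    hence "(of_int t / 2 :: rat) = 0" using rational_combination_eqD[OF d] y by metis
    thus False using t by simp
  qed
  obtain f :: "int poly" where f: "irreducible f" "poly (of_int_poly f) ?x = 0"
    "alg_mahler_measure ?x = mahler_measure f"
    using alg_mahler_measure_irreducible[of d ?x] d inK by auto
  have "(y * y - (y + z) * y + y * z) = 0" by (simp add: algebra_simps)
  hence "of_int c + y * (of_int (- b) + y) = 0" unfolding vieta by (simp add: algebra_simps)
  hence "complex_of_real (of_int c + y * (of_int (- b) + y)) = 0" by (simp only: of_real_0)
  hence "poly (of_int_poly [:c, - b, 1:]) ?x = 0" by (simp add: of_int_poly_quadratic)
  hence "f dvd [:c, - b, 1:]" by (intro irreducible_dvd_of_common_root[OF f(1) _ f(2)]) auto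
  hence "mahler_measure f \<le> mahler_measure [:c, - b, 1:]" by (intro mahler_measure_dvd) auto
  also have "\<dots> = max 1 \<bar>y\<bar> * max 1 \<bar>z\<bar>"
    using mahler_measure_quadratic[OF vieta] by simp
  also have "\<dots> = max 1 \<bar>y\<bar>" using b by (simp add: z_def max_def)
  also have "\<dots> < sqrt (of_int D)"
  proof -
    have s: "1 < sqrt (of_int D)" using D1 by simp
    have "0 < (u + v) / 2 \<and> (u + v) / 2 < v" if "1 < v" "v - 2 \<le> u" "u < v" for u v :: real
      using that by simp
    from this[OF s b] have "0 < y" "y < sqrt (of_int D)" by (simp_all only: y_def)
    thus ?thesis using s by (simp only: max_less_iff_conj abs_of_pos simp_thms)
  qed
  finally show ?thesis using f(3) inK \<open>?x \<notin> \<rat>\<close> by (auto simp: D_def intro!: bexI[of _ ?x])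
qed

theorem theorem1p1:
  fixes d :: int
  assumes "squarefree d" and "d \<ge> 2"
  shows "1 / 2 * sqrt (real_of_int (quadratic_discriminant d)) < min_mahler_measure d \<and>
         min_mahler_measure d < sqrt (real_of_int (quadratic_discriminant d))"
proof
  obtain x where x: "x \<in> quadratic_field d - \<rat>"
    and small: "alg_mahler_measure x < sqrt (real_of_int (quadratic_discriminant d))"
    using exists_small_mahler_measure[OF assms] by blast
  show "min_mahler_measure d < sqrt (real_of_int (quadratic_discriminant d))"
    using min_mahler_measure_attained(2)[OF assms x] small by linarith
  obtain y where y: "y \<in> quadratic_field d - \<rat>" and min: "min_mahler_measure d = alg_mahler_measure y"
    using min_mahler_measure_attained(1)[OF assms x] by blast
  obtain f :: "int poly" where f: "irreducible f" "poly (of_int_poly f) y = 0"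
    "alg_mahler_measure y = mahler_measure f"
    using alg_mahler_measure_irreducible[of d y] assms y by auto
  show "1 / 2 * sqrt (real_of_int (quadratic_discriminant d)) < min_mahler_measure d"
    using minimal_polynomial_quadratic(2)[OF assms y f(1,2)] min f(3) by simp
qed

end
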